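(* Let $k$ and $n\geq 0$ be integers and let $(E_N)_{N\in\mathbb{N}}\in\prod_{N\in\mathbb{N}}\mathbb{C}[\mathcal{P}_k(N)]$. The sequence $(E_N)_{N\in\mathbb{N}}$ converges in moments up to the $n^{th}$ order of fluctuations if and only if for any $p\in\mathcal{P}_k$ and any $i\in\{0,\dots,n\}$ there exists a real $\kappa_p^i(E)$ such that for any $p\in\mathcal{P}_k$, $$N^n\left(\kappa_p(E_N)-\sum_{i=0}^{n-1}\frac{\kappa_p^i(E)}{N^i}\right)\underset{N\to\infty}{\longrightarrow}\kappa_p^n(E).$$ If $(E_N)_{N\in\mathbb{N}}$ converges in moments up to the $n^{th}$ order of fluctuations, then for any $p\in\mathcal{P}_k$ and any $i_0\in\{0,\dots,n\}$, $$m_p^{i_0}(E)=\sum_{p'\in\mathcal{P}_k,\ \mathrm{df}(p',p)\leq i_0}\kappa_{p'}^{i_0-\mathrm{df}(p',p)}(E).$$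
   Context: $\mathcal{P}_k$ is the set of partitions of $\{1,\dots,k\}\cup\{1',\dots,k'\}$ ($1,\dots,k$ top row, $1',\dots,k'$ bottom row), $\mathrm{id}_k=\{\{i,i'\}:1\le i\le k\}$. $\mathrm{nc}(p)$ is the number of blocks, $p\vee p'$ the finest partition coarser than both, $d(p,p')=\frac12(\mathrm{nc}(p)+\mathrm{nc}(p'))-\mathrm{nc}(p\vee p')$. The defect is $$\mathrm{df}(p',p)=d(\mathrm{id}_k,p')+d(p',p)-d(\mathrm{id}_k,p)=\mathrm{nc}(p')-\mathrm{nc}(p'\vee\mathrm{id}_k)-\mathrm{nc}(p\vee p')+\mathrm{nc}(p\vee\mathrm{id}_k),$$ a non-negative integer. Composition: $p\circ p'$ is obtained by putting a diagram of $p'$ above one of $p$, identifying the bottom vertex $i'$ of $p'$ with the top vertex $i$ of $p$, and taking the partition of top and bottom rows induced by the connected components; $\kappa(p,p')$ is the number of connected components entirely contained in the middle row. ${}^tp$ is $p$ with $i$ and $i'$ exchanged for all $i$. The partition algebra $\mathbb{C}[\mathcal{P}_k(N)]$ has basis $\mathcal{P}_k$ and product $p_1p_2=N^{\kappa(p_1,p_2)}(p_1\circ p_2)$; $\mathrm{Tr}_N$ is the linear form with $\mathrm{Tr}_N(p)=N^{\mathrm{nc}(p\vee\mathrm{id}_k)}$. For $E\in\mathbb{C}[\mathcal{P}_k(N)]$: $m_p(E)=\frac{1}{\mathrm{Tr}_N(p)}\mathrm{Tr}_N(E\,{}^tp)$ and $\kappa_p(E)=N^{\mathrm{nc}(p)-\mathrm{nc}(p\vee\mathrm{id}_k)}E_p$,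 $E_p$ being the coordinate of $E$ on $p$. The sequence $(E_N)_N$ converges in moments up to the $n^{th}$ order of fluctuations if for any $p\in\mathcal{P}_k$ and any $i\in\{0,\dots,n\}$ there exists a real $m_p^i(E)$ such that $$N^n\left(m_p(E_N)-\sum_{i=0}^{n-1}\frac{m_p^i(E)}{N^i}\right)\underset{N\to\infty}{\longrightarrow}m_p^n(E).$$ *)

theory Defs
  imports Complex_Main "HOL-Library.Disjoint_Sets"
begin

section \<open>Partitions of two rows of k vertices\<close>

datatype vertex = Top nat | Bot nat

definition vertices :: "nat \<Rightarrow> vertex set" where
  "vertices k = Top ` {1..k} \<union> Bot ` {1..k}"

definition parts :: "nat \<Rightarrow> vertex set set set" where
  "parts k = {p. partition_on (vertices k) p}"

definition id_part :: "nat \<Rightarrow> vertex set set" where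
  "id_part k = (\<lambda>i. {Top i, Bot i}) ` {1..k}"

abbreviation nc :: "'a set set \<Rightarrow> nat" where
  "nc p \<equiv> card p"

text \<open>The relation \<^term>\<open>refines A p r\<close> says that \<open>p\<close> is finer than \<open>r\<close>. Existence and uniqueness
  of the finest common coarsening are shown in \<open>join_eq_components\<close> below.\<close>

definition join :: "nat \<Rightarrow> vertex set set \<Rightarrow> vertex set set \<Rightarrow> vertex set set" where
  "join k p q = (THE r.
     refines (vertices k) p r \<and> refines (vertices k) q r \<and>
     (\<forall>s. refines (vertices k) p s \<and> refines (vertices k) q s \<longrightarrow> refines (vertices k) r s))"

definition pdist :: "nat \<Rightarrow> vertex set set \<Rightarrow> vertex set set \<Rightarrow> real" where
  "pdist k p q = (real (nc p) + real (nc q)) / 2 - real (nc (join k p q))"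

text \<open>The defect is used as an index, so it is given by its integer expression; \<open>defect_eq_pdist\<close>
  identifies it with the triangle defect of \<^const>\<open>pdist\<close>.\<close>

definition defect :: "nat \<Rightarrow> vertex set set \<Rightarrow> vertex set set \<Rightarrow> int" where
  "defect k p' p = int (nc p') - int (nc (join k p' (id_part k)))
     - int (nc (join k p p')) + int (nc (join k p (id_part k)))"

lemma join_commute: "join k p q = join k q p"
  unfolding join_def by (rule arg_cong[where f = The]) blast

lemma defect_eq_pdist:
  "real_of_int (defect k p' p) = pdist k (id_part k) p' + pdist k p' p - pdist k (id_part k) p"
  by (simp add: defect_def pdist_def join_commute[of k p' p]
      join_commute[of k "id_part k" p] join_commute[of k "id_part k" p'] field_simps)

section \<open>Connected components\<close>

text \<open>The components of the graph on \<open>A\<close> in which two vertices are adjacent iff some member of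
  \<open>B\<close> contains both.\<close>

definition components :: "'a set \<Rightarrow> 'a set set \<Rightarrow> 'a set set" where
  "components A B =
     A // {(x, y). x \<in> A \<and> y \<in> A \<and> (x, y) \<in> {(u, v). \<exists>b\<in>B. u \<in> b \<and> v \<in> b}\<^sup>*}"

lemma equiv_components:
  "equiv A {(x, y). x \<in> A \<and> y \<in> A \<and> (x, y) \<in> {(u, v). \<exists>b\<in>B. u \<in> b \<and> v \<in> b}\<^sup>*}"
proof -
  have "sym ({(u, v). \<exists>b\<in>B. u \<in> b \<and> v \<in> b}\<^sup>*)"
    by (rule sym_rtrancl) (auto simp: sym_def)
  then show ?thesis
    by (auto simp: equiv_def refl_on_def sym_def trans_def intro: rtrancl_trans)
qed

lemma partition_on_components: "partition_on A (components A B)"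
  unfolding components_def by (rule partition_on_quotient[OF equiv_components])

lemma refines_components:
  assumes p: "partition_on A p" and "p \<subseteq> B"
  shows "refines A p (components A B)"
  unfolding refines_def
proof (intro conjI ballI p partition_on_components)
  fix X assume X: "X \<in> p"
  then obtain x where x: "x \<in> X" using partition_onD3[OF p] by (metis ex_in_conv)
  have XA: "X \<subseteq> A" using X partition_onD1[OF p] by auto
  let ?R = "{(x, y). x \<in> A \<and> y \<in> A \<and> (x, y) \<in> {(u, v). \<exists>b\<in>B. u \<in> b \<and> v \<in> b}\<^sup>*}"
  have "?R `` {x} \<in> components A B"
    unfolding components_def by (rule quotientI) (use x XA in auto)
  moreover have "X \<subseteq> ?R `` {x}"
    using x X XA assms(2) by (auto intro!: r_into_rtrancl)
  ultimately show "\<exists>Y\<in>components A B. X \<subseteq> Y" by blast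
qed

lemma components_least:
  assumes p: "refines A p s" and q: "refines A q s"
  shows "refines A (components A (p \<union> q)) s"
proof -
  have s: "partition_on A s" using p by (simp add: refines_def)
  have adj: "v \<in> S" if "S \<in> s" "u \<in> S" "b \<in> p \<union> q" "u \<in> b" "v \<in> b" for S u v b
  proof -
    obtain T where "T \<in> s" and "b \<subseteq> T" using \<open>b \<in> p \<union> q\<close> p q by (auto simp: refines_def)
    moreover have "T = S"
      using disjointD[OF partition_onD2[OF s] \<open>T \<in> s\<close> \<open>S \<in> s\<close>] \<open>b \<subseteq> T\<close> that by blast
    ultimately show ?thesis using \<open>v \<in> b\<close> by blast
  qed
  have closed: "y \<in> S"
    if "(x, y) \<in> {(u, v). \<exists>b\<in>p \<union> q. u \<in> b \<and> v \<in> b}\<^sup>*" "S \<in> s" "x \<in> S" for x y S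
    using that(1)
  proof (induction rule: rtrancl_induct)
    case base
    show ?case by (rule that(3))
  next
    case (step y z)
    then obtain b where "b \<in> p \<union> q" "y \<in> b" "z \<in> b" by auto
    then show ?case using adj[OF that(2) step.IH] by auto
  qed
  show ?thesis
    unfolding refines_def
  proof (intro conjI ballI s partition_on_components)
    fix X assume "X \<in> components A (p \<union> q)"
    then obtain x where x: "x \<in> A"
      and X: "X \<subseteq> {y. (x, y) \<in> {(u, v). \<exists>b\<in>p \<union> q. u \<in> b \<and> v \<in> b}\<^sup>*}"
      unfolding components_def by (auto elim!: quotientE)
    obtain S where "S \<in> s" "x \<in> S" using x partition_onD1[OF s] by auto
    then show "\<exists>Y\<in>s. X \<subseteq> Y" using X closed by blast
  qed
qed

lemma join_eq_components:
  assumes "p \<in> parts k" "q \<in> parts k"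
  shows "join k p q = components (vertices k) (p \<union> q)"
  unfolding join_def
proof (rule the_equality)
  show *: "refines (vertices k) p (components (vertices k) (p \<union> q)) \<and>
    refines (vertices k) q (components (vertices k) (p \<union> q)) \<and>
    (\<forall>s. refines (vertices k) p s \<and> refines (vertices k) q s
       \<longrightarrow> refines (vertices k) (components (vertices k) (p \<union> q)) s)"
    using assms by (auto simp: parts_def intro!: refines_components components_least)
  show "r = components (vertices k) (p \<union> q)"
    if "refines (vertices k) p r \<and> refines (vertices k) q r \<and>
      (\<forall>s. refines (vertices k) p s \<and> refines (vertices k) q s \<longrightarrow> refines (vertices k) r s)" for r
    by (rule refines_asym[of "vertices k"]) (use that * in simp_all)
qed

section \<open>Composition and transposition\<close>

text \<open>Three rows of vertices: \<open>Middle i\<close> is at once the bottom vertex \<open>i'\<close> of the upper diagram and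
  the top vertex \<open>i\<close> of the lower one.\<close>

datatype vertex3 = Upper nat | Middle nat | Lower nat

definition vertices3 :: "nat \<Rightarrow> vertex3 set" where
  "vertices3 k = Upper ` {1..k} \<union> Middle ` {1..k} \<union> Lower ` {1..k}"

primrec in_upper :: "vertex \<Rightarrow> vertex3" where
  "in_upper (Top i) = Upper i"
| "in_upper (Bot i) = Middle i"

primrec in_lower :: "vertex \<Rightarrow> vertex3" where
  "in_lower (Top i) = Middle i"
| "in_lower (Bot i) = Lower i"

primrec in_outer :: "vertex \<Rightarrow> vertex3" where
  "in_outer (Top i) = Upper i"
| "in_outer (Bot i) = Lower i"

text \<open>The diagram of \<open>p'\<close> is put above the diagram of \<open>p\<close>.\<close>

definition stacked :: "nat \<Rightarrow> vertex set set \<Rightarrow> vertex set set \<Rightarrow> vertex3 set set" where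
  "stacked k p p' = components (vertices3 k) ((`) in_upper ` p' \<union> (`) in_lower ` p)"

definition compose_parts :: "nat \<Rightarrow> vertex set set \<Rightarrow> vertex set set \<Rightarrow> vertex set set" where
  "compose_parts k p p' = (-`) in_outer ` stacked k p p' - {{}}"

definition loops :: "nat \<Rightarrow> vertex set set \<Rightarrow> vertex set set \<Rightarrow> nat" where
  "loops k p p' = card {C \<in> stacked k p p'. C \<subseteq> Middle ` {1..k}}"

lemma compose_parts_in_parts: "compose_parts k p p' \<in> parts k"
proof -
  have "in_outer -` vertices3 k = vertices k"
  proof (rule set_eqI)
    show "v \<in> in_outer -` vertices3 k \<longleftrightarrow> v \<in> vertices k" for v
      by (cases v) (auto simp: vertices3_def vertices_def)
  qed
  then show ?thesis
    unfolding compose_parts_def parts_def stacked_def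
    using partition_on_vimage[OF partition_on_components, of in_outer "vertices3 k"] by simp
qed

primrec flip :: "vertex \<Rightarrow> vertex" where
  "flip (Top i) = Bot i"
| "flip (Bot i) = Top i"

definition transp_part :: "vertex set set \<Rightarrow> vertex set set" where
  "transp_part p = (`) flip ` p"

section \<open>The partition algebra\<close>

text \<open>An element is given by its coordinates in the basis \<^term>\<open>parts k\<close>. The parameter \<open>N\<close> only
  enters the product and the trace.\<close>

definition palg :: "nat \<Rightarrow> (vertex set set \<Rightarrow> complex) set" where
  "palg k = {E. \<forall>p. p \<notin> parts k \<longrightarrow> E p = 0}"

definition basis :: "vertex set set \<Rightarrow> vertex set set \<Rightarrow> complex" where
  "basis p = (\<lambda>q. if q = p then 1 else 0)"

definition palg_mult ::
  "nat \<Rightarrow> nat \<Rightarrow> (vertex set set \<Rightarrow> complex) \<Rightarrow> (vertex set set \<Rightarrow> complex)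
    \<Rightarrow> vertex set set \<Rightarrow> complex" where
  "palg_mult k N E F = (\<lambda>q. \<Sum>p\<^sub>1\<in>parts k. \<Sum>p\<^sub>2\<in>parts k.
     E p\<^sub>1 * F p\<^sub>2 * of_nat N ^ loops k p\<^sub>1 p\<^sub>2 * basis (compose_parts k p\<^sub>1 p\<^sub>2) q)"

definition palg_trace :: "nat \<Rightarrow> nat \<Rightarrow> (vertex set set \<Rightarrow> complex) \<Rightarrow> complex" where
  "palg_trace k N E = (\<Sum>p\<in>parts k. E p * of_nat N ^ nc (join k p (id_part k)))"

definition moment ::
  "nat \<Rightarrow> nat \<Rightarrow> (vertex set set \<Rightarrow> complex) \<Rightarrow> vertex set set \<Rightarrow> complex" where
  "moment k N E p =
     palg_trace k N (palg_mult k N E (basis (transp_part p))) / palg_trace k N (basis p)"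

definition cumulant ::
  "nat \<Rightarrow> nat \<Rightarrow> (vertex set set \<Rightarrow> complex) \<Rightarrow> vertex set set \<Rightarrow> complex" where
  "cumulant k N E p =
     of_nat N powi (int (nc p) - int (nc (join k p (id_part k)))) * E p"

section \<open>Convergence up to a given order of fluctuations\<close>

definition expands :: "nat \<Rightarrow> (nat \<Rightarrow> complex) \<Rightarrow> (nat \<Rightarrow> real) \<Rightarrow> bool" where
  "expands n x c \<longleftrightarrow>
     (\<lambda>N. of_nat N ^ n * (x N - (\<Sum>i<n. complex_of_real (c i) / of_nat N ^ i)))
       \<longlonglongrightarrow> complex_of_real (c n)"

text \<open>In the following two definitions only the values \<open>m p i\<close> and \<open>c p i\<close> with \<^term>\<open>p \<in> parts k\<close>
  and \<open>i \<le> n\<close> matter.\<close>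

definition moment_expansion ::
  "nat \<Rightarrow> nat \<Rightarrow> (nat \<Rightarrow> vertex set set \<Rightarrow> complex) \<Rightarrow> (vertex set set \<Rightarrow> nat \<Rightarrow> real) \<Rightarrow> bool" where
  "moment_expansion k n E m \<longleftrightarrow> (\<forall>p\<in>parts k. expands n (\<lambda>N. moment k N (E N) p) (m p))"

definition cumulant_expansion ::
  "nat \<Rightarrow> nat \<Rightarrow> (nat \<Rightarrow> vertex set set \<Rightarrow> complex) \<Rightarrow> (vertex set set \<Rightarrow> nat \<Rightarrow> real) \<Rightarrow> bool" where
  "cumulant_expansion k n E c \<longleftrightarrow> (\<forall>p\<in>parts k. expands n (\<lambda>N. cumulant k N (E N) p) (c p))"

definition converges_in_moments ::
  "nat \<Rightarrow> nat \<Rightarrow> (nat \<Rightarrow> vertex set set \<Rightarrow> complex) \<Rightarrow> bool" where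
  "converges_in_moments k n E \<longleftrightarrow> (\<exists>m. moment_expansion k n E m)"

end

(* Folding the bottom row of the stacked diagram back onto its top row gives
   kappa(q, tp) + nc((q o tp) v id) = nc(p v q), so the moments are the sums over q of
   kappa_q(E) / N^df(q, p). The defect is non-negative because adding the k edges of id to a graph
   costs at most as many components when more edges are already present. If df(q, p) = 0 then
   d(id, p) - d(id, q) = d(q, p), hence this linear system is unitriangular up to terms of order 1/N
   for the ordering by d(id, .). Expansions of the cumulants therefore follow from those of the
   moments order by order, starting from the bound K <= C (1 + K/N) on the sum K of the absolute
   values of the cumulants. *)
theory Submission
  imports Defs "HOL-Library.Landau_Symbols"
begin

section \<open>Counting connected components\<close>

text \<open>The closure inside the definition of \<open>components\<close>, detached from the vertex
  set: its paths may leave \<open>A\<close>.\<close>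

definition conn :: "'a set set \<Rightarrow> ('a \<times> 'a) set" where
  "conn B = {(u, v). \<exists>b\<in>B. u \<in> b \<and> v \<in> b}\<^sup>*"

lemma conn_refl [simp, intro]: "(x, x) \<in> conn B"
  by (simp add: conn_def)

lemma conn_trans: "(x, y) \<in> conn B \<Longrightarrow> (y, z) \<in> conn B \<Longrightarrow> (x, z) \<in> conn B"
  unfolding conn_def by (rule rtrancl_trans)

lemma conn_sym: "(x, y) \<in> conn B \<Longrightarrow> (y, x) \<in> conn B"
  unfolding conn_def by (erule symD[OF sym_rtrancl, rotated]) (auto simp: sym_def)

lemma conn_block: "b \<in> B \<Longrightarrow> u \<in> b \<Longrightarrow> v \<in> b \<Longrightarrow> (u, v) \<in> conn B"
  unfolding conn_def by (rule r_into_rtrancl) auto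

lemma conn_induct [consumes 1, case_names base step]:
  assumes "(x, y) \<in> conn B" "P x"
    "\<And>y z b. (x, y) \<in> conn B \<Longrightarrow> b \<in> B \<Longrightarrow> y \<in> b \<Longrightarrow> z \<in> b \<Longrightarrow> P y \<Longrightarrow> P z"
  shows "P y"
  using assms(1,2) unfolding conn_def
proof (induction rule: rtrancl_induct)
  case (step y z)
  then obtain b where "b \<in> B" "y \<in> b" "z \<in> b" by auto
  then show ?case using assms(3)[of y b z] step unfolding conn_def by simp
qed

text \<open>Paths are transported block by block, so only two vertices of one block need checking;
  \<open>f\<close> may lead to another vertex set.\<close>

lemma conn_map:
  assumes "(x, y) \<in> conn B"
    and "\<And>b u v. b \<in> B \<Longrightarrow> u \<in> b \<Longrightarrow> v \<in> b \<Longrightarrow> (f u, f v) \<in> conn B'"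
  shows "(f x, f y) \<in> conn B'"
  using assms(1)
proof (induction rule: conn_induct)
  case (step y z b)
  then show ?case using assms(2) conn_trans by metis
qed (rule conn_refl)

lemma conn_mono:
  assumes "(x, y) \<in> conn B" "B \<subseteq> B'"
  shows "(x, y) \<in> conn B'"
  using conn_map[OF assms(1), of "\<lambda>x. x" B'] assms(2) conn_block by (metis subsetD)

text \<open>As a function of the vertex, this turns \<open>components\<close> into an image, and
  counting components into counting values.\<close>

definition component :: "'a set \<Rightarrow> 'a set set \<Rightarrow> 'a \<Rightarrow> 'a set" where
  "component A B x = {y \<in> A. (x, y) \<in> conn B}"

lemma components_eq_image: "components A B = component A B ` A"
proof -
  have "{(x, y). x \<in> A \<and> y \<in> A \<and> (x, y) \<in> conn B} `` {x} = component A B x" if "x \<in> A" for x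
    using that by (auto simp: component_def)
  then show ?thesis
    unfolding components_def conn_def[symmetric] quotient_def by (simp add: image_def) blast
qed

lemma component_eq_iff:
  assumes "x \<in> A" "y \<in> A"
  shows "component A B x = component A B y \<longleftrightarrow> (x, y) \<in> conn B"
proof
  assume "component A B x = component A B y"
  then have "y \<in> component A B x" using assms by (simp add: component_def)
  then show "(x, y) \<in> conn B" by (simp add: component_def)
next
  assume "(x, y) \<in> conn B"
  then have "(x, z) \<in> conn B \<longleftrightarrow> (y, z) \<in> conn B" for z
    using conn_trans conn_sym by metis
  then show "component A B x = component A B y" by (simp add: component_def)
qed

lemma mem_component: "y \<in> component A B x \<longleftrightarrow> y \<in> A \<and> (x, y) \<in> conn B"
  by (simp add: component_def)

lemma finite_components: "finite A \<Longrightarrow> finite (components A B)"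
  by (simp add: components_eq_image)

section \<open>Numbers of values of maps that factor through each other\<close>

lemma image_factor:
  assumes "\<And>x y. x \<in> A \<Longrightarrow> y \<in> A \<Longrightarrow> f x = f y \<Longrightarrow> g x = g y"
  obtains h where "\<And>x. x \<in> A \<Longrightarrow> g x = h (f x)"
proof
  show "g x = g (inv_into A f (f x))" if "x \<in> A" for x
  proof (rule assms[OF that])
    show "inv_into A f (f x) \<in> A" using that by (intro inv_into_into imageI)
    show "f x = f (inv_into A f (f x))" using that by (intro f_inv_into_f[symmetric] imageI)
  qed
qed

text \<open>\<open>g\<close> factors through \<open>f\<close> on \<open>A\<close>. Applied to maps
  \<open>component\<close>, this compares numbers of components without building bijections.\<close>

lemma card_image_mono:
  assumes "finite A" "\<And>x y. x \<in> A \<Longrightarrow> y \<in> A \<Longrightarrow> f x = f y \<Longrightarrow> g x = g y"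
  shows "card (g ` A) \<le> card (f ` A)"
proof -
  obtain h where "\<And>x. x \<in> A \<Longrightarrow> g x = h (f x)"
    using image_factor[of A f g] assms(2) by blast
  then have "g ` A = h ` f ` A" by (simp add: image_image)
  then show ?thesis using assms(1) by (simp add: card_image_le)
qed

lemma card_image_cong:
  assumes "finite A" "\<And>x y. x \<in> A \<Longrightarrow> y \<in> A \<Longrightarrow> f x = f y \<longleftrightarrow> g x = g y"
  shows "card (f ` A) = card (g ` A)"
  by (rule order.antisym; rule card_image_mono) (use assms in auto)

text \<open>Equality case of \<open>card_image_mono\<close>: the factor map from the values of
  \<open>f\<close> onto those of \<open>g\<close> is injective.\<close>

lemma card_image_eq_imp:
  assumes "finite A" "\<And>x y. x \<in> A \<Longrightarrow> y \<in> A \<Longrightarrow> f x = f y \<Longrightarrow> g x = g y"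
    and "card (g ` A) = card (f ` A)" "x \<in> A" "y \<in> A" "g x = g y"
  shows "f x = f y"
proof -
  obtain h where h: "\<And>x. x \<in> A \<Longrightarrow> g x = h (f x)"
    using image_factor[of A f g] assms(2) by blast
  then have "g ` A = h ` f ` A" by (simp add: image_image)
  then have "inj_on h (f ` A)"
    using assms(1,3) by (intro eq_card_imp_inj_on) simp_all
  then show ?thesis
    by (rule inj_onD) (use assms(4-6) h in simp_all)
qed

section \<open>Components when blocks or edges are added\<close>

lemma card_components_mono:
  assumes "finite A" "B \<subseteq> B'"
  shows "card (components A B') \<le> card (components A B)"
  unfolding components_eq_image
  using assms by (intro card_image_mono) (auto simp: component_eq_iff intro: conn_mono)

text \<open>Blocks are disjoint, so no path leaves one. This turns \<open>nc p\<close> into a number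
  of components, like the other terms of the defect.\<close>

lemma components_partition:
  assumes "partition_on A p"
  shows "components A p = p"
proof -
  have component: "component A p x = X" if "X \<in> p" "x \<in> X" for x X
  proof
    show "X \<subseteq> component A p x"
      using that partition_onD1[OF assms] by (auto simp: mem_component intro: conn_block)
    have "y \<in> X" if "(x, y) \<in> conn p" for y
      using that
    proof (induction rule: conn_induct)
      case (step y z b)
      then show ?case
        using partition_onD2[OF assms] \<open>X \<in> p\<close> by (auto dest: disjointD)
    qed (rule \<open>x \<in> X\<close>)
    then show "component A p x \<subseteq> X" by (auto simp: mem_component)
  qed
  show ?thesis
  proof
    show "components A p \<subseteq> p"
      using component partition_onD1[OF assms] by (auto simp: components_eq_image)
    show "p \<subseteq> components A p"
    proof
      fix X assume X: "X \<in> p"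
      then obtain x where "x \<in> X" using partition_onD3[OF assms] by (metis ex_in_conv)
      then show "X \<in> components A p"
        using X component[of X x] partition_onD1[OF assms] unfolding components_eq_image by blast
    qed
  qed
qed

text \<open>A path needs to cross the new edge at most once, in one of its two directions.\<close>

lemma conn_insert_edge:
  "(u, v) \<in> conn (insert {x, y} B) \<longleftrightarrow>
    (u, v) \<in> conn B \<or> (u, x) \<in> conn B \<and> (y, v) \<in> conn B \<or> (u, y) \<in> conn B \<and> (x, v) \<in> conn B"
  (is "?L \<longleftrightarrow> ?R")
proof
  show ?R if ?L
    using that
  proof (induction rule: conn_induct)
    case (step v w b)
    show ?case
    proof (cases "b \<in> B")
      case True
      then have "(v, w) \<in> conn B" using step by (auto intro: conn_block)
      then show ?thesis using step.IH conn_trans[of _ v B w] by blast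
    next
      case False
      then have "b = {x, y}" using step by auto
      then have "v = x \<or> v = y" "w = x \<or> w = y" using step by auto
      then show ?thesis using step.IH by (elim disjE conjE) auto
    qed
  qed auto
  have B: "(s, t) \<in> conn (insert {x, y} B)" if "(s, t) \<in> conn B" for s t
    using that by (rule conn_mono) auto
  have "(x, y) \<in> conn (insert {x, y} B)" by (rule conn_block[of "{x, y}"]) auto
  then show ?L if ?R
    using that B by (meson conn_sym conn_trans)
qed

lemma card_components_insert_edge:
  assumes "finite A" "x \<in> A" "y \<in> A"
  shows "int (card (components A (insert {x, y} B)))
    = int (card (components A B)) - (if (x, y) \<in> conn B then 0 else 1)"
proof (cases "(x, y) \<in> conn B")
  case True
  then have "(u, v) \<in> conn (insert {x, y} B) \<longleftrightarrow> (u, v) \<in> conn B" for u v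
    unfolding conn_insert_edge using conn_trans conn_sym by metis
  then have "component A (insert {x, y} B) = component A B"
    by (simp add: component_def fun_eq_iff)
  then show ?thesis using True by (simp add: components_eq_image)
next
  case False
  \<comment> \<open>\<open>?g\<close> redirects the class of \<open>y\<close> to that of
    \<open>x\<close>: on \<open>A\<close> it has the fibres of the merged graph, and its values are
    the old classes without that of \<open>y\<close>.\<close>
  let ?g = "\<lambda>u. if (u, y) \<in> conn B then component A B x else component A B u"
  have "component A (insert {x, y} B) u = component A (insert {x, y} B) v \<longleftrightarrow> ?g u = ?g v"
    if "u \<in> A" "v \<in> A" for u v
  proof -
    have "(u, v) \<in> conn (insert {x, y} B) \<longleftrightarrow>
        (if (u, y) \<in> conn B then (v, y) \<in> conn B \<or> (x, v) \<in> conn B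
         else if (v, y) \<in> conn B then (u, x) \<in> conn B else (u, v) \<in> conn B)"
      unfolding conn_insert_edge using conn_sym[of _ _ B] conn_trans[of _ _ B] False by metis
    then show ?thesis
      using that assms conn_sym[of x v B] conn_sym[of v x B] by (auto simp: component_eq_iff)
  qed
  then have "card (components A (insert {x, y} B)) = card (?g ` A)"
    unfolding components_eq_image by (rule card_image_cong[OF assms(1)])
  also have "?g ` A = components A B - {component A B y}"
  proof -
    have "component A B x \<noteq> component A B y"
      using False component_eq_iff[OF assms(2,3)] by blast
    then have "components A B - {component A B y}
        = (\<lambda>C. if C = component A B y then component A B x else C) ` components A B"
      using assms(2) by (auto simp: components_eq_image)
    also have "\<dots> = ?g ` A"
      unfolding components_eq_image image_image
      by (rule image_cong[OF refl]) (simp add: component_eq_iff[OF _ assms(3)])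
    finally show ?thesis by (rule sym)
  qed
  also have "card \<dots> = card (components A B) - 1"
    using assms by (simp add: components_eq_image)
  also have "int \<dots> = int (card (components A B)) - 1"
  proof -
    have "card (components A B) > 0"
      using assms by (auto simp: components_eq_image card_gt_0_iff)
    then show ?thesis by simp
  qed
  finally show ?thesis using False by simp
qed

text \<open>Adding an edge lowers the number of components by one or zero, and the drop can only shrink when
  other blocks are already present.\<close>

lemma card_components_supermodular:
  assumes "finite A" "finite F" "B \<subseteq> B'"
    and "\<And>e. e \<in> F \<Longrightarrow> \<exists>x\<in>A. \<exists>y\<in>A. e = {x, y}"
  shows "int (card (components A B')) - int (card (components A (B' \<union> F)))
    \<le> int (card (components A B)) - int (card (components A (B \<union> F)))"
  using assms(2,4)
proof (induction F rule: finite_induct)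
  case (insert e F)
  then obtain x y where e: "x \<in> A" "y \<in> A" "e = {x, y}" by blast
  \<comment> \<open>An edge that is redundant over the smaller graph is redundant over the larger
    one, so each single drop is no larger for \<open>B'\<close> than for \<open>B\<close>.\<close>
  have "(x, y) \<in> conn (B' \<union> F)" if "(x, y) \<in> conn (B \<union> F)"
    using that by (rule conn_mono) (use assms in auto)
  with insert.IH insert.prems show ?case
    using card_components_insert_edge[OF assms(1) e(1,2), of "B \<union> F"]
      card_components_insert_edge[OF assms(1) e(1,2), of "B' \<union> F"]
    by (auto simp: e(3) split: if_splits)
qed simp

section \<open>Joins of partitions and the defect\<close>

lemma finite_vertices [simp]: "finite (vertices k)"
  by (simp add: vertices_def)

lemma finite_parts: "finite (parts k)"
  unfolding parts_def by (rule finitely_many_partition_on) simp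

lemma id_part_in_parts: "id_part k \<in> parts k"
  unfolding parts_def id_part_def
  by (auto simp: partition_on_def vertices_def disjoint_def)

lemma parts_D: "p \<in> parts k \<Longrightarrow> partition_on (vertices k) p"
  by (simp add: parts_def)

lemma nc_eq: "p \<in> parts k \<Longrightarrow> nc p = card (components (vertices k) p)"
  by (simp add: components_partition parts_D)

lemma nc_join_le:
  assumes "p \<in> parts k" "q \<in> parts k"
  shows "nc (join k p q) \<le> nc p" "nc (join k p q) \<le> nc q"
  by (simp_all add: assms join_eq_components nc_eq[OF assms(1)] nc_eq[OF assms(2)]
      card_components_mono)

text \<open>The join is coarser than \<open>p\<close>, and the equality case of the counting makes
  the two equivalences agree. It serves to separate points in \<open>id_dist_less\<close>.\<close>

lemma eq_join_if_card_eq: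
  assumes p: "p \<in> parts k" and q: "q \<in> parts k" and "nc (join k p q) = nc p"
  shows "p = join k p q"
proof -
  let ?A = "vertices k"
  have le: "component ?A (p \<union> q) x = component ?A (p \<union> q) y"
    if "x \<in> ?A" "y \<in> ?A" "component ?A p x = component ?A p y" for x y
    using that conn_mono[of x y p "p \<union> q"] by (simp add: component_eq_iff)
  have card: "card (component ?A (p \<union> q) ` ?A) = card (component ?A p ` ?A)"
    unfolding components_eq_image[symmetric] join_eq_components[OF p q, symmetric]
    using assms(3) nc_eq[OF p] by metis
  have ge: "component ?A p x = component ?A p y"
    if "x \<in> ?A" "y \<in> ?A" "component ?A (p \<union> q) x = component ?A (p \<union> q) y" for x y
    using card_image_eq_imp[where A = ?A and f = "component ?A p", OF finite_vertices le card that] .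
  have "component ?A p x = component ?A (p \<union> q) x" if "x \<in> ?A" for x
  proof -
    have "(x, y) \<in> conn p \<longleftrightarrow> (x, y) \<in> conn (p \<union> q)" if "y \<in> ?A" for y
      using le[OF \<open>x \<in> ?A\<close> that] ge[OF \<open>x \<in> ?A\<close> that]
      unfolding component_eq_iff[OF \<open>x \<in> ?A\<close> that] by blast
    then show ?thesis by (auto simp: component_def)
  qed
  then have "components ?A p = components ?A (p \<union> q)"
    unfolding components_eq_image by (rule image_cong[OF refl])
  then show ?thesis using join_eq_components[OF p q] components_partition[OF parts_D[OF p]] by simp
qed

text \<open>The triangle inequality for \<open>pdist\<close>. Supermodularity bounds the defect
  below by the loss of components from \<open>p \<union> id_part k\<close> to
  \<open>p \<union> q \<union> id_part k\<close>.\<close>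

lemma defect_nonneg:
  assumes p: "p \<in> parts k" and q: "q \<in> parts k"
  shows "0 \<le> defect k q p"
proof -
  let ?c = "\<lambda>B. int (card (components (vertices k) B))"
  have "?c (p \<union> q) - ?c (p \<union> q \<union> id_part k) \<le> ?c q - ?c (q \<union> id_part k)"
    by (rule card_components_supermodular) (auto simp: id_part_def vertices_def)
  moreover have "?c (p \<union> q \<union> id_part k) \<le> ?c (p \<union> id_part k)"
    by (auto intro!: card_components_mono)
  ultimately show ?thesis
    using p q by (simp add: defect_def join_eq_components id_part_in_parts nc_eq)
qed

lemma join_self: "p \<in> parts k \<Longrightarrow> join k p p = p"
  by (simp add: join_eq_components components_partition parts_D)

lemma defect_self: "p \<in> parts k \<Longrightarrow> defect k p p = 0"
  by (simp add: defect_def join_self)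

text \<open>Twice the distance of \<open>p\<close> to the identity; the subtraction does not truncate, by \<open>nc_join_le\<close>.\<close>

definition id_dist :: "nat \<Rightarrow> vertex set set \<Rightarrow> nat" where
  "id_dist k p = nc p + nc (id_part k) - 2 * nc (join k p (id_part k))"

text \<open>With zero defect, \<open>q\<close> lies on a geodesic from the identity to
  \<open>p\<close>, so the two distances to the identity differ by the distance from
  \<open>q\<close> to \<open>p\<close>, which is positive.\<close>

lemma id_dist_less:
  assumes p: "p \<in> parts k" and q: "q \<in> parts k" and "defect k q p = 0" "q \<noteq> p"
  shows "id_dist k q < id_dist k p"
proof -
  \<comment> \<open>Equality in both bounds of \<open>nc_join_le\<close> would make \<open>p\<close>
    and \<open>q\<close> both equal to their join.\<close>
  have "\<not> (nc (join k p q) = nc p \<and> nc (join k p q) = nc q)"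
    using eq_join_if_card_eq[OF p q] eq_join_if_card_eq[OF q p] assms(4)
    by (metis join_commute)
  then have "2 * nc (join k p q) < nc p + nc q"
    using nc_join_le[OF p q] by linarith
  then show ?thesis
    using assms(3) nc_join_le[OF p id_part_in_parts] nc_join_le[OF q id_part_in_parts]
    unfolding defect_def id_dist_def by linarith
qed

section \<open>Tracing a graph on a subset of its vertices\<close>

text \<open>Shrinking a graph to a subset of its vertices, given as the range of \<open>j\<close>: the blocks \<open>E\<close> only
  touch the subset, and the components of \<open>B\<close> are replaced by their traces.\<close>

context
  fixes j :: "'b \<Rightarrow> 'a" and O' :: "'b set" and A :: "'a set" and B :: "'a set set" and E :: "'b set set"
  assumes inj: "inj j" and sub: "j ` O' \<subseteq> A" and E: "\<Union>E \<subseteq> O'"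
    and vimage: "j -` A \<subseteq> O'"
begin

text \<open>A path is cut at its steps through blocks of \<open>E\<close>. Each stretch in between
  stays in one component of \<open>B\<close>, whose trace is a single block.\<close>

lemma conn_trace_iff:
  assumes "x \<in> O'" "y \<in> O'"
  shows "(j x, j y) \<in> conn (B \<union> (`) j ` E) \<longleftrightarrow>
    (x, y) \<in> conn ((-`) j ` components A B - {{}} \<union> E)" (is "_ \<longleftrightarrow> _ \<in> conn ?T")
proof
  have trace: "(u, v) \<in> conn ?T" if "(j u, j v) \<in> conn B" "u \<in> O'" "v \<in> O'" for u v
  proof (rule conn_block[of "j -` component A B (j u)"])
    show "j -` component A B (j u) \<in> ?T"
      using that sub by (auto simp: components_eq_image mem_component set_eq_iff)
  qed (use that sub in \<open>auto simp: mem_component\<close>)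
  \<comment> \<open>Invariant along the path: the current vertex is joined by \<open>B\<close> alone
    to a point of the subset that the traced graph already reaches.\<close>
  have "\<exists>u\<in>O'. (x, u) \<in> conn ?T \<and> (j u, z) \<in> conn B" if "(j x, z) \<in> conn (B \<union> (`) j ` E)" for z
    using that
  proof (induction rule: conn_induct)
    case base
    show ?case using assms by auto
  next
    case (step z w b)
    then obtain u where u: "u \<in> O'" "(x, u) \<in> conn ?T" "(j u, z) \<in> conn B" by blast
    show ?case
    proof (cases "b \<in> B")
      case True
      then have "(z, w) \<in> conn B" using step conn_block by metis
      then show ?thesis using u conn_trans by metis
    next
      case False
      then obtain e z' w' where e: "e \<in> E" "z' \<in> e" "w' \<in> e" "z = j z'" "w = j w'" using step by auto
      then have "(x, z') \<in> conn ?T" using u trace[of u z'] E by (blast intro: conn_trans)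
      moreover have "(z', w') \<in> conn ?T" using e by (blast intro: conn_block)
      ultimately show ?thesis using e E by (blast intro: conn_trans)
    qed
  qed
  then show "(x, y) \<in> conn ?T" if "(j x, j y) \<in> conn (B \<union> (`) j ` E)"
    using that trace assms(2) by (blast intro: conn_trans)
  show "(j x, j y) \<in> conn (B \<union> (`) j ` E)" if "(x, y) \<in> conn ?T"
    using that
  proof (rule conn_map)
    fix b u v assume b: "b \<in> ?T" "u \<in> b" "v \<in> b"
    show "(j u, j v) \<in> conn (B \<union> (`) j ` E)"
    proof (cases "b \<in> E")
      case True
      then show ?thesis using b by (blast intro: conn_block)
    next
      case False
      then obtain a where "(a, j u) \<in> conn B" "(a, j v) \<in> conn B"
        using b by (auto simp: components_eq_image mem_component)
      then have "(j u, j v) \<in> conn B" by (blast intro: conn_trans conn_sym)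
      then show ?thesis by (rule conn_mono) auto
    qed
  qed
qed

text \<open>A component that misses the subset meets no added block and survives unchanged; those
  that meet it correspond to the components of the traced graph.\<close>

lemma card_components_trace:
  assumes "finite A"
  shows "card (components A (B \<union> (`) j ` E)) =
    card {C \<in> components A B. C \<inter> range j = {}}
      + card (components O' ((-`) j ` components A B - {{}} \<union> E))"
proof -
  let ?B = "B \<union> (`) j ` E"
  have finite_O: "finite O'"
    using finite_subset[OF sub assms] inj by (meson finite_imageD inj_on_subset subset_UNIV)
  \<comment> \<open>Before its first step through an added block, a path has reached the subset by
    \<open>B\<close> alone.\<close>
  have conn_B: "(x, y) \<in> conn B \<or> (\<exists>u\<in>O'. (x, j u) \<in> conn B)" if "(x, y) \<in> conn ?B" for x y
    using that
  proof (induction rule: conn_induct)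
    case (step y z b)
    then show ?case using E by (blast intro: conn_trans conn_block)
  qed auto
  have conn_B': "(x, y) \<in> conn ?B" if "(x, y) \<in> conn B" for x y
    using that by (rule conn_mono) auto
  have iff: "component A ?B x \<inter> range j = {} \<longleftrightarrow> component A B x \<inter> range j = {}" for x
  proof -
    have "(\<exists>u. j u \<in> component A ?B x) \<longleftrightarrow> (\<exists>u. j u \<in> component A B x)"
    proof
      assume "\<exists>u. j u \<in> component A ?B x"
      then obtain u where "j u \<in> A" "(x, j u) \<in> conn ?B" by (auto simp: mem_component)
      then obtain u' where "j u' \<in> A" "(x, j u') \<in> conn B" using conn_B[of x "j u"] sub by blast
      then show "\<exists>u. j u \<in> component A B x" by (auto simp: mem_component)
    next
      assume "\<exists>u. j u \<in> component A B x"
      then show "\<exists>u. j u \<in> component A ?B x" using conn_B' by (auto simp: mem_component)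
    qed
    then show ?thesis by blast
  qed
  have eq: "component A ?B x = component A B x" if "component A B x \<inter> range j = {}" for x
  proof -
    have "(x, y) \<in> conn ?B \<longleftrightarrow> (x, y) \<in> conn B" for y
      using conn_B[of x y] conn_B'[of x y] that sub by (auto simp: mem_component disjoint_iff)
    then show ?thesis by (auto simp: component_def)
  qed
  have "components A ?B = {C \<in> components A ?B. C \<inter> range j = {}}
      \<union> {C \<in> components A ?B. C \<inter> range j \<noteq> {}}" by blast
  then have "card (components A ?B) = card {C \<in> components A ?B. C \<inter> range j = {}}
      + card {C \<in> components A ?B. C \<inter> range j \<noteq> {}}"
    using finite_components[OF assms, of ?B]
    by (subst card_Un_disjoint[symmetric]) auto
  also have "{C \<in> components A ?B. C \<inter> range j = {}} = {C \<in> components A B. C \<inter> range j = {}}"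
  proof -
    have "C = component A ?B x \<and> C \<inter> range j = {} \<longleftrightarrow> C = component A B x \<and> C \<inter> range j = {}"
      for x C using iff[of x] eq[of x] by auto
    then have "(\<exists>x\<in>A. C = component A ?B x \<and> C \<inter> range j = {})
        \<longleftrightarrow> (\<exists>x\<in>A. C = component A B x \<and> C \<inter> range j = {})" for C
      by simp
    then show ?thesis
      unfolding components_eq_image image_iff by (simp add: bex_simps)
  qed
  also have "{C \<in> components A ?B. C \<inter> range j \<noteq> {}} = (component A ?B \<circ> j) ` O'"
  proof (rule set_eqI, rule iffI)
    fix C assume "C \<in> {C \<in> components A ?B. C \<inter> range j \<noteq> {}}"
    then obtain x u where x: "x \<in> A" and C: "C = component A ?B x" and "j u \<in> C"
      unfolding components_eq_image by blast
    then have u: "j u \<in> A" "(x, j u) \<in> conn ?B" by (simp_all add: mem_component)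
    then have "C = component A ?B (j u)" using x C by (simp add: component_eq_iff)
    then show "C \<in> (component A ?B \<circ> j) ` O'" using vimage u by auto
  next
    fix C assume "C \<in> (component A ?B \<circ> j) ` O'"
    then show "C \<in> {C \<in> components A ?B. C \<inter> range j \<noteq> {}}"
      using sub by (fastforce simp: components_eq_image mem_component disjoint_iff)
  qed
  also have "card \<dots> = card (components O' ((-`) j ` components A B - {{}} \<union> E))"
    unfolding components_eq_image[of O']
  proof (rule card_image_cong[OF finite_O])
    fix u v assume uv: "u \<in> O'" "v \<in> O'"
    then have "j u \<in> A" "j v \<in> A" using sub by auto
    then show "(component A ?B \<circ> j) u = (component A ?B \<circ> j) v \<longleftrightarrow>
      component O' ((-`) j ` components A B - {{}} \<union> E) u = component O' ((-`) j ` components A B - {{}} \<union> E) v"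
      using uv conn_trace_iff[OF uv] by (simp add: component_eq_iff)
  qed
  finally show ?thesis .
qed

end

section \<open>Transposition and folding of the stacked diagram\<close>

lemma flip_flip [simp]: "flip (flip v) = v"
  by (cases v) simp_all

lemma flip_in_vertices [simp]: "flip v \<in> vertices k \<longleftrightarrow> v \<in> vertices k"
  by (cases v) (auto simp: vertices_def)

lemma transp_part_in_parts:
  assumes "p \<in> parts k"
  shows "transp_part p \<in> parts k"
proof -
  have "inj_on flip (vertices k)" by (metis flip_flip inj_on_inverseI)
  moreover have "flip ` vertices k = vertices k"
  proof
    show "vertices k \<subseteq> flip ` vertices k"
    proof
      show "v \<in> flip ` vertices k" if "v \<in> vertices k" for v
        by (rule image_eqI[of _ _ "flip v"]) (simp_all add: that)
    qed
  qed auto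
  moreover have "(`) flip ` p - {{}} = transp_part p"
    using partition_onD3[OF parts_D[OF assms]] by (auto simp: transp_part_def)
  ultimately show ?thesis
    using partition_on_inj_image[OF parts_D[OF assms], of flip] by (simp add: parts_def)
qed

text \<open>Both outer rows go to the bottom row, as if identified. The upper diagram is thereby
  flipped, which undoes its transposition.\<close>

primrec fold_row :: "vertex3 \<Rightarrow> vertex" where
  "fold_row (Upper i) = Bot i"
| "fold_row (Middle i) = Top i"
| "fold_row (Lower i) = Bot i"

lemma fold_row_in_lower [simp]: "fold_row (in_lower v) = v"
  by (cases v) simp_all

lemma fold_row_in_upper [simp]: "fold_row (in_upper v) = flip v"
  by (cases v) simp_all

lemma finite_vertices3: "finite (vertices3 k)"
  by (simp add: vertices3_def)

text \<open>In the trace of a product with a transpose the outer rows are identified as well, so that folding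
  the three rows of the stacked diagram onto two superposes the two partitions.\<close>

lemma card_components_folded:
  assumes p: "p \<in> parts k" and q: "q \<in> parts k"
  shows "card (components (vertices3 k)
      ((`) in_upper ` transp_part p \<union> (`) in_lower ` q \<union> (`) in_outer ` id_part k))
    = card (components (vertices k) (p \<union> q))"
    (is "card (components _ ?B) = _")
proof -
  \<comment> \<open>The edges between the outer rows connect each vertex to the lower-diagram vertex
    with the same fold, so \<open>in_lower\<close> inverts \<open>fold_row\<close> up to
    connectivity.\<close>
  have row: "(x, in_lower (fold_row x)) \<in> conn ?B" if "x \<in> vertices3 k" for x
  proof (cases x)
    case (Upper i)
    then have "{Top i, Bot i} \<in> id_part k" using that by (auto simp: id_part_def vertices3_def)
    then have "in_outer ` {Top i, Bot i} \<in> ?B" by blast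
    then show ?thesis by (rule conn_block) (simp_all add: Upper)
  qed simp_all
  have conn_iff: "(x, y) \<in> conn ?B \<longleftrightarrow> (fold_row x, fold_row y) \<in> conn (p \<union> q)"
    if x: "x \<in> vertices3 k" and y: "y \<in> vertices3 k" for x y
  proof
    show "(fold_row x, fold_row y) \<in> conn (p \<union> q)" if "(x, y) \<in> conn ?B"
      using that
    proof (rule conn_map)
      fix b u v assume "b \<in> ?B" "u \<in> b" "v \<in> b"
      then show "(fold_row u, fold_row v) \<in> conn (p \<union> q)"
        by (auto simp: transp_part_def id_part_def intro: conn_block)
    qed
    assume "(fold_row x, fold_row y) \<in> conn (p \<union> q)"
    then have "(in_lower (fold_row x), in_lower (fold_row y)) \<in> conn ?B"
    proof (rule conn_map)
      fix b u v assume b: "b \<in> p \<union> q" "u \<in> b" "v \<in> b"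
      show "(in_lower u, in_lower v) \<in> conn ?B"
      proof (cases "b \<in> q")
        case True
        then show ?thesis using b by (blast intro: conn_block)
      next
        case False
        \<comment> \<open>A vertex of \<open>p\<close> occurs flipped in the upper diagram;
          \<open>row\<close> connects this copy to the one in the lower diagram.\<close>
        have in_upper: "(in_upper (flip w), in_lower w) \<in> conn ?B" if "w \<in> b" for w
        proof -
          have "w \<in> vertices k" using that b p q by (auto simp: parts_def partition_on_def)
          then have "in_upper (flip w) \<in> vertices3 k"
            by (cases w) (auto simp: vertices_def vertices3_def)
          from row[OF this] show ?thesis by simp
        qed
        have "(in_upper (flip u), in_upper (flip v)) \<in> conn ?B"
          by (rule conn_block[of "in_upper ` flip ` b"]) (use False b in \<open>auto simp: transp_part_def\<close>)
        then show ?thesis using in_upper b by (blast intro: conn_trans conn_sym)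
      qed
    qed
    then show "(x, y) \<in> conn ?B" using row[OF x] row[OF y] by (blast intro: conn_trans conn_sym)
  qed
  have image: "fold_row ` vertices3 k = vertices k"
    by (auto simp: vertices_def vertices3_def image_Un image_image)
  then have "card (components (vertices3 k) ?B)
      = card ((component (vertices k) (p \<union> q) \<circ> fold_row) ` vertices3 k)"
    unfolding components_eq_image
  proof (intro card_image_cong finite_vertices3)
    fix x y assume xy: "x \<in> vertices3 k" "y \<in> vertices3 k"
    then have "fold_row x \<in> vertices k" "fold_row y \<in> vertices k" using image by auto
    then show "component (vertices3 k) ?B x = component (vertices3 k) ?B y \<longleftrightarrow>
        (component (vertices k) (p \<union> q) \<circ> fold_row) x = (component (vertices k) (p \<union> q) \<circ> fold_row) y"
      using conn_iff[OF xy] by (simp only: o_apply component_eq_iff xy)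
  qed
  also have "\<dots> = card (components (vertices k) (p \<union> q))"
    by (simp only: image_comp[symmetric] image components_eq_image)
  finally show ?thesis .
qed

text \<open>Both sides count the components of the stacked diagram closed up by edges between its
  outer rows: the left by tracing on the outer rows, the right by folding.\<close>

lemma loops_add_nc_join:
  assumes p: "p \<in> parts k" and q: "q \<in> parts k"
  shows "loops k q (transp_part p) + nc (join k (compose_parts k q (transp_part p)) (id_part k))
    = nc (join k p q)"
proof -
  let ?B = "(`) in_upper ` transp_part p \<union> (`) in_lower ` q"
  have stacked: "stacked k q (transp_part p) = components (vertices3 k) ?B" by (simp add: stacked_def)
  have outer: "in_outer v \<in> vertices3 k \<longleftrightarrow> v \<in> vertices k" for v
    by (cases v) (auto simp: vertices_def vertices3_def)
  have "inj in_outer"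
  proof (rule injI)
    show "u = v" if "in_outer u = in_outer v" for u v
      using that by (cases u; cases v) simp_all
  qed
  then have "card (components (vertices3 k) (?B \<union> (`) in_outer ` id_part k)) =
      card {C \<in> components (vertices3 k) ?B. C \<inter> range in_outer = {}}
      + card (components (vertices k) ((-`) in_outer ` components (vertices3 k) ?B - {{}} \<union> id_part k))"
    using id_part_in_parts[of k] outer
    by (intro card_components_trace) (auto simp: finite_vertices3 parts_def partition_on_def)
  moreover have "C \<inter> range in_outer = {} \<longleftrightarrow> C \<subseteq> Middle ` {1..k}" if "C \<subseteq> vertices3 k" for C
  proof
    assume disj: "C \<inter> range in_outer = {}"
    have "in_outer (Top i) \<notin> C" "in_outer (Bot i) \<notin> C" for i using disj by blast+
    then show "C \<subseteq> Middle ` {1..k}" using that by (auto simp: vertices3_def)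
  next
    assume "C \<subseteq> Middle ` {1..k}"
    moreover have "in_outer v \<notin> range Middle" for v by (cases v) auto
    ultimately show "C \<inter> range in_outer = {}" by blast
  qed
  then have "{C \<in> components (vertices3 k) ?B. C \<inter> range in_outer = {}}
      = {C \<in> stacked k q (transp_part p). C \<subseteq> Middle ` {1..k}}"
    unfolding stacked by (auto simp: components_eq_image component_def)
  ultimately show ?thesis
    using card_components_folded[OF p q]
      join_eq_components[OF compose_parts_in_parts[of k q "transp_part p"] id_part_in_parts]
    by (simp add: loops_def compose_parts_def join_eq_components[OF p q] stacked)
qed

section \<open>Traces, and moments as sums of cumulants\<close>

lemma palg_trace_basis:
  assumes "p \<in> parts k"
  shows "palg_trace k N (basis p) = of_nat N ^ nc (join k p (id_part k))"
proof -
  have "palg_trace k N (basis p)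
      = (\<Sum>q\<in>parts k. if q = p then of_nat N ^ nc (join k q (id_part k)) else 0)"
    unfolding palg_trace_def basis_def by (rule sum.cong) auto
  then show ?thesis using assms finite_parts by (simp add: sum.delta)
qed

text \<open>By linearity it suffices to treat basis elements, where the loop exponent and the trace
  exponent add up by \<open>loops_add_nc_join\<close>.\<close>

lemma palg_trace_mult_transp:
  assumes p: "p \<in> parts k"
  shows "palg_trace k N (palg_mult k N E (basis (transp_part p)))
    = (\<Sum>q\<in>parts k. E q * of_nat N ^ nc (join k p q))"
proof -
  let ?t = "transp_part p"
  have "palg_mult k N E (basis ?t) r
      = (\<Sum>q\<in>parts k. E q * of_nat N ^ loops k q ?t * basis (compose_parts k q ?t) r)" for r
  proof -
    have "palg_mult k N E (basis ?t) r = (\<Sum>q\<in>parts k. \<Sum>s\<in>parts k. if s = ?t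
        then E q * of_nat N ^ loops k q s * basis (compose_parts k q s) r else 0)"
      unfolding palg_mult_def by (intro sum.cong) (auto simp: basis_def)
    then show ?thesis by (simp add: finite_parts transp_part_in_parts[OF p])
  qed
  then have "palg_trace k N (palg_mult k N E (basis ?t))
      = (\<Sum>q\<in>parts k. E q * of_nat N ^ loops k q ?t * palg_trace k N (basis (compose_parts k q ?t)))"
    unfolding palg_trace_def
    by (simp only: sum_distrib_right sum_distrib_left mult.assoc) (rule sum.swap)
  also have "\<dots> = (\<Sum>q\<in>parts k. E q * of_nat N ^ nc (join k p q))"
  proof (rule sum.cong[OF refl])
    fix q assume q: "q \<in> parts k"
    show "E q * of_nat N ^ loops k q ?t * palg_trace k N (basis (compose_parts k q ?t))
        = E q * of_nat N ^ nc (join k p q)"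
      unfolding palg_trace_basis[OF compose_parts_in_parts] loops_add_nc_join[OF p q, symmetric]
      by (simp add: power_add)
  qed
  finally show ?thesis .
qed

text \<open>The exponent nc(p v q) - nc(p v id) equals nc(q) - nc(q v id), the normalization of the
  cumulant, minus the defect.\<close>

lemma moment_eq_sum_cumulant:
  assumes p: "p \<in> parts k" and "N > 0"
  shows "moment k N E p
    = (\<Sum>q\<in>parts k. cumulant k N E q / of_nat N ^ nat (defect k q p))"
proof -
  have "moment k N E p
      = (\<Sum>q\<in>parts k. E q * of_nat N ^ nc (join k p q) / of_nat N ^ nc (join k p (id_part k)))"
    by (simp add: moment_def palg_trace_mult_transp palg_trace_basis p sum_divide_distrib)
  also have "\<dots> = (\<Sum>q\<in>parts k. cumulant k N E q / of_nat N ^ nat (defect k q p))"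
  proof (rule sum.cong[OF refl])
    fix q assume q: "q \<in> parts k"
    have N: "(of_nat N :: complex) \<noteq> 0" using assms by simp
    \<comment> \<open>Integer powers are used because nc(p v q) - nc(p v id) can be negative;
      \<open>nat\<close> changes nothing on a non-negative defect.\<close>
    have "cumulant k N E q / of_nat N ^ nat (defect k q p)
        = E q * (of_nat N powi (int (nc q) - int (nc (join k q (id_part k)))) / of_nat N powi defect k q p)"
      using defect_nonneg[OF p q] by (simp add: cumulant_def power_int_def)
    also have "\<dots> = E q * of_nat N powi (int (nc (join k p q)) - int (nc (join k p (id_part k))))"
      by (simp add: power_int_diff[OF disjI1[OF N], symmetric] defect_def)
    also have "\<dots> = E q * of_nat N ^ nc (join k p q) / of_nat N ^ nc (join k p (id_part k))"
      by (simp add: power_int_diff[OF disjI1[OF N]])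
    finally show "E q * of_nat N ^ nc (join k p q) / of_nat N ^ nc (join k p (id_part k))
        = cumulant k N E q / of_nat N ^ nat (defect k q p)" ..
  qed
  finally show ?thesis .
qed

section \<open>Expansions in powers of \<open>1/N\<close>\<close>

lemma eventually_at_top_pos: "\<forall>\<^sub>F N :: nat in sequentially. N > 0"
  by (rule eventually_gt_at_top)

text \<open>Only large \<open>N\<close> and coefficients up to \<open>n\<close> enter, so the
  default value of division at \<open>N = 0\<close> is harmless.\<close>

lemma expands_cong:
  assumes "expands n x c" "\<forall>\<^sub>F N in sequentially. x N = y N" "\<And>i. i \<le> n \<Longrightarrow> c i = d i"
  shows "expands n y d"
proof -
  have *: "(\<Sum>i<n. complex_of_real (c i) / of_nat N ^ i) = (\<Sum>i<n. complex_of_real (d i) / of_nat N ^ i)" for N :: nat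
    by (rule sum.cong) (use assms(3) in auto)
  show ?thesis
    using assms(1) unfolding expands_def * assms(3)[OF order.refl]
    by (rule Lim_transform_eventually) (use assms(2) in \<open>auto elim!: eventually_mono\<close>)
qed

lemma expands_add:
  assumes "expands n x c" "expands n y d"
  shows "expands n (\<lambda>N. x N + y N) (\<lambda>i. c i + d i)"
  using tendsto_add[OF assms[unfolded expands_def]]
  by (simp add: expands_def add_divide_distrib sum.distrib algebra_simps)

lemma expands_minus:
  assumes "expands n x c"
  shows "expands n (\<lambda>N. - x N) (\<lambda>i. - c i)"
  using tendsto_minus[OF assms[unfolded expands_def]]
  by (simp add: expands_def sum_negf algebra_simps)

lemma expands_zero: "expands n (\<lambda>N. 0) (\<lambda>i. 0)"
  by (simp add: expands_def)

lemma expands_sum: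
  assumes "\<And>q. q \<in> S \<Longrightarrow> expands n (x q) (c q)"
  shows "expands n (\<lambda>N. \<Sum>q\<in>S. x q N) (\<lambda>i. \<Sum>q\<in>S. c q i)"
proof (cases "finite S")
  case True
  then show ?thesis
    using assms by (induction S) (auto intro: expands_zero expands_add)
qed (simp add: expands_zero)

text \<open>For \<open>N > 0\<close> the scaled remainder of order \<open>n\<close> is that of order
  \<open>Suc n\<close> divided by \<open>N\<close>, plus \<open>c n\<close>; the first summand
  vanishes in the limit.\<close>

lemma expands_Suc_imp:
  assumes "expands (Suc n) x c"
  shows "expands n x c"
proof -
  let ?s = "\<lambda>N. \<Sum>i<n. complex_of_real (c i) / of_nat N ^ i"
  let ?t = "\<lambda>N. of_nat N ^ Suc n * (x N - (\<Sum>i<Suc n. complex_of_real (c i) / of_nat N ^ i))"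
  have "(\<lambda>N. ?t N * inverse (of_nat N) + complex_of_real (c n))
      \<longlonglongrightarrow> complex_of_real (c (Suc n)) * 0 + complex_of_real (c n)"
    using assms unfolding expands_def by (intro tendsto_intros lim_inverse_n)
  then have "(\<lambda>N. ?t N * inverse (of_nat N) + complex_of_real (c n)) \<longlonglongrightarrow> complex_of_real (c n)"
    by simp
  then show ?thesis
    unfolding expands_def
    by (rule Lim_transform_eventually)
      (rule eventually_mono[OF eventually_at_top_pos], simp add: field_simps)
qed

lemma expands_mono:
  assumes "expands n x c" "j \<le> n"
  shows "expands j x c"
  using assms(2,1) by (induction rule: inc_induct) (auto intro: expands_Suc_imp)

text \<open>Once the lower coefficients agree, \<open>c i\<close> and \<open>d i\<close> are limits
  of the same sequence.\<close>

lemma expands_unique: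
  assumes "expands n x c" "expands n x d" "i \<le> n"
  shows "c i = d i"
  using assms(3)
proof (induction i rule: less_induct)
  case (less i)
  then have c: "expands i x c" and d: "expands i x d"
    using assms expands_mono by auto
  have "expands i x (d(i := c i))"
    by (rule expands_cong[OF c]) (use less in auto)
  then have "(\<lambda>N. of_nat N ^ i * (x N - (\<Sum>j<i. complex_of_real (d j) / of_nat N ^ j)))
      \<longlonglongrightarrow> complex_of_real (c i)"
    by (simp add: expands_def)
  with d show ?case
    unfolding expands_def using LIMSEQ_unique of_real_eq_iff by blast
qed

text \<open>Division by \<open>N ^ d\<close> also raises the known order by \<open>d\<close>; this
  gain drives the induction in \<open>expands_x\<close>.\<close>

lemma expands_shift_add:
  assumes "expands n x c"
  shows "expands (n + d) (\<lambda>N. x N / of_nat N ^ d) (\<lambda>i. if i < d then 0 else c (i - d))"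
proof -
  have "(\<Sum>i<n + d. complex_of_real (if i < d then 0 else c (i - d)) / of_nat N ^ i)
      = (\<Sum>i<n. complex_of_real (c i) / of_nat N ^ i) / of_nat N ^ d" for N :: nat
  proof -
    have "(\<Sum>i<n + d. complex_of_real (if i < d then 0 else c (i - d)) / of_nat N ^ i)
        = (\<Sum>i\<in>{d..<n + d}. complex_of_real (if i < d then 0 else c (i - d)) / of_nat N ^ i)"
      by (rule sum.mono_neutral_right) auto
    also have "\<dots> = (\<Sum>i<n. complex_of_real (c i) / of_nat N ^ (i + d))"
      using sum.shift_bounds_nat_ivl[of "\<lambda>i. complex_of_real (c (i - d)) / of_nat N ^ i" 0 d n]
      by (simp add: lessThan_atLeast0)
    finally show ?thesis
      by (simp add: sum_divide_distrib power_add)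
  qed
  then show ?thesis
    using assms unfolding expands_def
    by (auto elim!: Lim_transform_eventually intro!: eventually_mono[OF eventually_at_top_pos]
        simp: power_add field_simps)
qed

lemma expands_shift:
  assumes "expands n x c"
  shows "expands n (\<lambda>N. x N / of_nat N ^ d) (\<lambda>i. if i < d then 0 else c (i - d))"
  using expands_mono[OF expands_shift_add[OF assms]] by simp

lemma expands_imp_bounded:
  assumes "expands n x c"
  shows "x \<in> O(\<lambda>_. 1)"
proof -
  have "x \<longlonglongrightarrow> complex_of_real (c 0)"
    using expands_mono[OF assms, of 0] by (simp add: expands_def)
  then have "((\<lambda>N. x N / 1) \<longlongrightarrow> complex_of_real (c 0)) sequentially" by simp
  then show ?thesis by (rule bigoI_tendsto) simp
qed

lemma bounded_imp_expands:
  assumes "x \<in> O(\<lambda>_. 1)"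
  shows "expands 0 (\<lambda>N. x N / of_nat N) (\<lambda>_. 0)"
proof -
  have "(\<lambda>N. 1 / of_nat N) \<in> o(\<lambda>_. 1 :: complex)"
    using lim_inverse_n[where 'a = complex] by (intro smalloI_tendsto) (simp_all add: inverse_eq_divide)
  then have "(\<lambda>N. x N * (1 / of_nat N)) \<in> o(\<lambda>_. 1 * 1)"
    by (rule landau_o.big_small_mult[OF assms])
  then show ?thesis
    using smalloD_tendsto[of _ sequentially "\<lambda>_. 1"] by (fastforce simp: expands_def)
qed

section \<open>Linear systems that are unitriangular up to terms of order 1/N\<close>

locale unitriangular_system =
  fixes S :: "'a set" and a :: "'a \<Rightarrow> 'a \<Rightarrow> nat" and rank :: "'a \<Rightarrow> nat"
    and x y :: "'a \<Rightarrow> nat \<Rightarrow> complex"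
  assumes finite_S: "finite S"
    and diag: "p \<in> S \<Longrightarrow> a p p = 0"
    and rank_less: "p \<in> S \<Longrightarrow> q \<in> S \<Longrightarrow> a q p = 0 \<Longrightarrow> q \<noteq> p \<Longrightarrow> rank q < rank p"
    and system: "p \<in> S \<Longrightarrow> N > 0 \<Longrightarrow> y p N = (\<Sum>q\<in>S. x q N / of_nat N ^ a q p)"
begin

lemma expands_y:
  assumes "p \<in> S" "\<And>q. q \<in> S \<Longrightarrow> expands n (x q) (c q)"
  shows "expands n (y p) (\<lambda>i. \<Sum>q\<in>S. if i < a q p then 0 else c q (i - a q p))"
proof (rule expands_cong[OF expands_sum])
  show "expands n (\<lambda>N. x q N / of_nat N ^ a q p) (\<lambda>i. if i < a q p then 0 else c q (i - a q p))"
    if "q \<in> S" for q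
    using assms(2)[OF that] by (rule expands_shift)
  show "\<forall>\<^sub>F N in sequentially. (\<Sum>q\<in>S. x q N / of_nat N ^ a q p) = y p N"
    using eventually_at_top_pos by (rule eventually_mono) (simp add: system assms)
qed simp

text \<open>Isolates the diagonal term. In the remaining sum, indices with \<open>a q p = 0\<close>
  have smaller rank and all others carry a factor 1/N.\<close>

lemma solve:
  assumes "p \<in> S" "N > 0"
  shows "x p N = y p N + - (\<Sum>q\<in>S - {p}. x q N / of_nat N ^ a q p)"
  using assms finite_S by (simp add: system diag sum.remove[of S p])

lemma x_bounded:
  assumes y: "\<And>p. p \<in> S \<Longrightarrow> y p \<in> O(\<lambda>_. 1)" and "p \<in> S"
  shows "x p \<in> O(\<lambda>_. 1)"
proof -
  define K where "K N = (\<Sum>q\<in>S. cmod (x q N))" for N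
  \<comment> \<open>The comparison function involves the unknowns themselves: terms with a factor
    1/N can so far be bounded only through \<open>K\<close>.\<close>
  define g where "g N = complex_of_real (1 + K N / real N)" for N
  have K: "0 \<le> K N" for N by (simp add: K_def sum_nonneg)
  have norm_g: "norm (g N) = 1 + K N / real N" for N
    using K[of N] unfolding g_def norm_of_real by simp
  have x_le_K: "cmod (x q N) \<le> K N" if "q \<in> S" for q N
    unfolding K_def using that finite_S by (intro member_le_sum) auto
  have off_diag: "(\<lambda>N. x q N / of_nat N ^ a q p) \<in> O(g)" if "q \<in> S" "a q p > 0" for p q
  proof (rule landau_o.big_mono, rule eventually_mono[OF eventually_at_top_pos])
    fix N :: nat assume N: "N > 0"
    have "cmod (x q N / of_nat N ^ a q p) \<le> K N / real N ^ a q p"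
      by (simp add: norm_divide norm_power divide_right_mono x_le_K that)
    also have "\<dots> \<le> K N / real N ^ 1"
      using N K[of N] that by (intro divide_left_mono power_increasing) auto
    finally show "cmod (x q N / of_nat N ^ a q p) \<le> cmod (g N)"
      by (simp add: norm_g)
  qed
  have one: "(\<lambda>_. 1) \<in> O(g)"
    by (rule landau_o.big_mono) (simp add: norm_g K)
  \<comment> \<open>Terms with exponent zero are covered by induction on the rank, all others by
    \<open>off_diag\<close>.\<close>
  have x_g: "x p \<in> O(g)" if "p \<in> S" for p
    using that
  proof (induction p rule: measure_induct_rule[of rank])
    case (less p)
    have "(\<lambda>N. x q N / of_nat N ^ a q p) \<in> O(g)" if "q \<in> S - {p}" for q
      using that less off_diag[of q p] rank_less[OF less.prems, of q] by (cases "a q p = 0") auto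
    then have "(\<lambda>N. y p N + - (\<Sum>q\<in>S - {p}. x q N / of_nat N ^ a q p)) \<in> O(g)"
      using landau_o.big_trans[OF y[OF less.prems] one]
      by (intro sum_in_bigo(1) landau_o.big.uminus_in_iff[THEN iffD2] big_sum_in_bigo) auto
    then show ?case
      by (rule landau_o.big.in_cong[THEN iffD1, rotated])
        (rule eventually_mono[OF eventually_at_top_pos], use solve less.prems in auto)
  qed
  have "(\<lambda>N. complex_of_real (K N)) \<in> O(g)"
    unfolding K_def of_real_sum
  proof (rule big_sum_in_bigo)
    show "(\<lambda>N. complex_of_real (cmod (x q N))) \<in> O(g)" if "q \<in> S" for q
      using landau_o.big_trans[OF landau_o.big_mono x_g[OF that]] by simp
  qed
  then obtain C where C: "C > 0"
    and "\<forall>\<^sub>F N in sequentially. norm (complex_of_real (K N)) \<le> C * norm (g N)"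
    by (auto elim!: landau_o.bigE)
  then have "\<forall>\<^sub>F N in sequentially. K N \<le> C * (1 + K N / real N)"
    unfolding norm_of_real norm_g using K by (auto elim!: eventually_mono)
  \<comment> \<open>For such \<open>N\<close> the term \<open>C * (K N / N)\<close> is at most half
    of \<open>K N\<close>; absorbing it leaves \<open>K N \<le> 2 * C\<close>.\<close>
  moreover have "\<forall>\<^sub>F N in sequentially. real N \<ge> 2 * C"
    by (rule eventually_sequentiallyI[of "nat \<lceil>2 * C\<rceil>"]) linarith
  ultimately have "\<forall>\<^sub>F N in sequentially. norm (x p N) \<le> 2 * C * norm (1 :: complex)"
    using eventually_at_top_pos
  proof eventually_elim
    case (elim N)
    have "C * (K N / real N) \<le> K N / 2"
      using elim(2,3) K[of N] mult_right_mono[OF elim(2) K[of N]] by (simp add: field_simps)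
    moreover have "K N \<le> C + C * (K N / real N)"
      using elim(1) by (simp only: distrib_left mult_1_right)
    ultimately have "K N \<le> 2 * C" by linarith
    then show ?case
      using x_le_K[OF \<open>p \<in> S\<close>, of N] by simp
  qed
  then show ?thesis by (rule landau_o.bigI[rotated]) (use C in simp)
qed

text \<open>Induction on the rank settles exponent zero. For a positive exponent, one factor 1/N is
  spent on the known expansion of \<open>x q N / N\<close>, and the others shift it.\<close>

lemma expands_x_step:
  assumes y: "\<And>p. p \<in> S \<Longrightarrow> \<exists>c. expands j (y p) c"
    and x: "\<And>p. p \<in> S \<Longrightarrow> \<exists>c. expands j (\<lambda>N. x p N / of_nat N) c"
    and "p \<in> S"
  shows "\<exists>c. expands j (x p) c"
  using \<open>p \<in> S\<close>
proof (induction p rule: measure_induct_rule[of rank])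
  case (less p)
  have "\<exists>c. expands j (\<lambda>N. x q N / of_nat N ^ a q p) c" if q: "q \<in> S - {p}" for q
  proof (cases "a q p")
    case 0
    then show ?thesis using less q rank_less[OF less.prems, of q] by auto
  next
    case (Suc d)
    obtain c where "expands j (\<lambda>N. x q N / of_nat N) c" using x q by auto
    from expands_shift[OF this, of d] show ?thesis by (auto simp: Suc)
  qed
  then obtain c where c: "\<And>q. q \<in> S - {p} \<Longrightarrow> expands j (\<lambda>N. x q N / of_nat N ^ a q p) (c q)"
    by metis
  obtain d where d: "expands j (y p) d" using y less.prems by auto
  have "expands j (\<lambda>N. y p N + - (\<Sum>q\<in>S - {p}. x q N / of_nat N ^ a q p))
      (\<lambda>i. d i + - (\<Sum>q\<in>S - {p}. c q i))"
    by (intro expands_add expands_minus expands_sum c d)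
  then have "expands j (x p) (\<lambda>i. d i + - (\<Sum>q\<in>S - {p}. c q i))"
    by (rule expands_cong)
      (rule eventually_mono[OF eventually_at_top_pos], use solve less.prems in auto)
  then show ?case by blast
qed

text \<open>Each order of the expansion of \<open>x\<close> only needs the previous order in the off-diagonal terms that
  carry a negative power of \<open>N\<close>; boundedness plays the role of order \<open>-1\<close>.\<close>

lemma expands_x:
  assumes y: "\<And>p. p \<in> S \<Longrightarrow> \<exists>c. expands n (y p) c" and "p \<in> S"
  shows "\<exists>c. expands n (x p) c"
proof -
  have y': "\<exists>c. expands j (y p) c" if "j \<le> n" "p \<in> S" for j p
    using y that expands_mono by meson
  \<comment> \<open>The induction carries \<open>x p N / N\<close> rather than \<open>x p N\<close>,
    so that order 0 follows from boundedness; one step yields order \<open>j\<close> of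
    \<open>x\<close>, hence order \<open>Suc j\<close> after division by \<open>N\<close>.\<close>
  have "\<forall>p\<in>S. \<exists>c. expands j (\<lambda>N. x p N / of_nat N) c" if "j \<le> n" for j
    using that
  proof (induction j)
    case 0
    show ?case
      using x_bounded bounded_imp_expands y expands_imp_bounded by meson
  next
    case (Suc j)
    show ?case
    proof
      fix p assume "p \<in> S"
      then obtain c where "expands j (x p) c"
        using expands_x_step[of j p] Suc y'[of j] by (meson Suc_leD)
      from expands_shift_add[OF this, of 1]
      show "\<exists>c. expands (Suc j) (\<lambda>N. x p N / of_nat N) c" by auto
    qed
  qed
  then show ?thesis using expands_x_step[of n] assms by blast
qed

end

section \<open>Application to the moments and cumulants of a sequence\<close>

theorem theorem6p1:
  fixes k n :: nat and E :: "nat \<Rightarrow> vertex set set \<Rightarrow> complex"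
  assumes "\<And>N. E N \<in> palg k"
  shows "(converges_in_moments k n E \<longleftrightarrow> (\<exists>c. cumulant_expansion k n E c)) \<and>
    (converges_in_moments k n E \<longrightarrow>
      (\<forall>m c. moment_expansion k n E m \<and> cumulant_expansion k n E c \<longrightarrow>
        (\<forall>p\<in>parts k. \<forall>i\<^sub>0\<le>n.
          m p i\<^sub>0 = (\<Sum>p' | p' \<in> parts k \<and> defect k p' p \<le> int i\<^sub>0.
            c p' (nat (int i\<^sub>0 - defect k p' p))))))"
proof -
  \<comment> \<open>The cumulants are the unknowns, the moments the right-hand sides, and twice the
    distance to the identity is the rank.\<close>
  interpret unitriangular_system "parts k" "\<lambda>q p. nat (defect k q p)" "id_dist k"
    "\<lambda>p N. cumulant k N (E N) p" "\<lambda>p N. moment k N (E N) p"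
  proof
    show "finite (parts k)" by (rule finite_parts)
    show "nat (defect k p p) = 0" if "p \<in> parts k" for p
      using that by (simp add: defect_self)
    show "id_dist k q < id_dist k p"
      if "p \<in> parts k" "q \<in> parts k" "nat (defect k q p) = 0" "q \<noteq> p" for p q
      using that defect_nonneg[of p k q] by (intro id_dist_less) auto
    show "moment k N (E N) p = (\<Sum>q\<in>parts k. cumulant k N (E N) q / of_nat N ^ nat (defect k q p))"
      if "p \<in> parts k" "N > 0" for p N
      using that by (rule moment_eq_sum_cumulant)
  qed
  have cumulant_to_moment: "expands n (\<lambda>N. moment k N (E N) p)
      (\<lambda>i. \<Sum>q\<in>parts k. if i < nat (defect k q p) then 0 else c q (i - nat (defect k q p)))"
    if "cumulant_expansion k n E c" "p \<in> parts k" for c p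
    using that by (intro expands_y) (auto simp: cumulant_expansion_def)
  show ?thesis
  proof (intro conjI iffI impI allI ballI)
    assume "converges_in_moments k n E"
    then have "\<forall>p\<in>parts k. \<exists>c. expands n (\<lambda>N. cumulant k N (E N) p) c"
      by (intro ballI expands_x) (auto simp: converges_in_moments_def moment_expansion_def)
    then show "\<exists>c. cumulant_expansion k n E c"
      unfolding cumulant_expansion_def by (rule bchoice)
  next
    assume "\<exists>c. cumulant_expansion k n E c"
    then obtain c where "cumulant_expansion k n E c" by blast
    from cumulant_to_moment[OF this] show "converges_in_moments k n E"
      unfolding converges_in_moments_def moment_expansion_def by (intro exI ballI)
  next
    fix m c p i
    assume mc: "moment_expansion k n E m \<and> cumulant_expansion k n E c"
      and p: "p \<in> parts k" and i: "i \<le> n"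
    \<comment> \<open>Both sides are coefficients of expansions of the same moment, hence equal by
      uniqueness.\<close>
    have "m p i = (\<Sum>q\<in>parts k. if i < nat (defect k q p) then 0 else c q (i - nat (defect k q p)))"
      using mc p i by (intro expands_unique[OF _ cumulant_to_moment]) (auto simp: moment_expansion_def)
    \<comment> \<open>Truncated subtraction of naturals agrees with the integer form because the
      defect is non-negative.\<close>
    also have "\<dots> = (\<Sum>q\<in>parts k. if defect k q p \<le> int i then c q (nat (int i - defect k q p)) else 0)"
    proof (rule sum.cong[OF refl])
      fix q assume "q \<in> parts k"
      then have "0 \<le> defect k q p" using p by (intro defect_nonneg)
      then show "(if i < nat (defect k q p) then 0 else c q (i - nat (defect k q p)))
          = (if defect k q p \<le> int i then c q (nat (int i - defect k q p)) else 0)"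
        by (auto simp: nat_diff_distrib)
    qed
    also have "\<dots> = (\<Sum>q | q \<in> parts k \<and> defect k q p \<le> int i. c q (nat (int i - defect k q p)))"
      by (simp add: sum.inter_filter finite_parts)
    finally show "m p i = (\<Sum>q | q \<in> parts k \<and> defect k q p \<le> int i. c q (nat (int i - defect k q p)))" .
  qed
qed

end
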